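(* Let $\mathcal X_1,\mathcal X_2,\mathit\Theta$ be arbitrary measurable spaces and let $\mathbf E_1=\mathbf P_1(X_1|\Theta):\mathit\Theta\dashrightarrow\mathcal X_1$ and $\mathbf E_2=\mathbf P_2(X_2|\Theta):\mathit\Theta\dashrightarrow\mathcal X_2$ be experiments (Markov kernels) with parameter space $\mathit\Theta$. Then the following are equivalent: 1. $\mathbf E_1\succeq\mathbf E_2$; 2. there is a Markov kernel $\mathbf K(X_1,X_2|\Theta):\mathit\Theta\dashrightarrow\mathcal X_1\times\mathcal X_2$ with marginals $\mathbf P_1(X_1|\Theta)$ and $\mathbf P_2(X_2|\Theta)$ such that, on the transition probability space $((\mathcal X_1\times\mathcal X_2)\times\mathit\Theta,\mathbf K(X_1,X_2|\Theta))$: $$X_2\perp\!\!\!\perp_{\mathbf K(X_1,X_2|\Theta)}\Theta\mid X_1.$$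
   Context: A Markov kernel $\mathit\Theta\dashrightarrow\mathcal X$ assigns to each $\theta$ a probability measure on $\mathcal X$, measurably in $\theta$ on each measurable subset of $\mathcal X$. For $\mathbf Q(X_2|X_1):\mathcal X_1\dashrightarrow\mathcal X_2$ the composition is $(\mathbf Q(X_2|X_1)\circ\mathbf P_1(X_1|\Theta=\theta))(A)=\int\mathbf Q(X_2\in A|X_1=x_1)\,\mathbf P_1(X_1\in dx_1|\Theta=\theta)$. $\mathbf E_1\succeq\mathbf E_2$ ($\mathbf E_1$ is at least as informative as $\mathbf E_2$) means: there is a Markov kernel (garbling) $\mathbf Q(X_2|X_1):\mathcal X_1\dashrightarrow\mathcal X_2$, the same for all parameters, with $\mathbf P_2(X_2|\Theta=\theta)=\mathbf Q(X_2|X_1)\circ\mathbf P_1(X_1|\Theta=\theta)$ for every $\theta\in\mathit\Theta$. In 2., $X_1,X_2,\Theta$ are the coordinate projections on $(\mathcal X_1\times\mathcal X_2)\times\mathit\Theta$; for each $\theta$ let $\mathbf K(X_2,\Theta,X_1|\Theta=\theta)$ be the law of $(x_2,\theta,x_1)$ for $(x_1,x_2)\sim\mathbf K(X_1,X_2|\Theta=\theta)$. The transitional conditional independence $X_2\perp\!\!\!\perp_{\mathbf K(X_1,X_2|\Theta)}\Theta\mid X_1$ means: there exists a Markov kernel $\mathbf Q(X_2|X_1):\mathcal X_1\dashrightarrow\mathcal X_2$ with $\mathbf K(X_2,\Theta,X_1|\Theta)=\mathbf Q(X_2|X_1)\otimes\mathbf K(\Theta,X_1|\Theta)$, i.e.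 for every $\theta$ and measurable $A,D,C$: $\mathbf K(X_2\in A,\Theta\in D,X_1\in C|\Theta=\theta)=\int\mathbf 1_D(\theta')\mathbf 1_C(x_1)\,\mathbf Q(X_2\in A|X_1=x_1)\,\mathbf K((\Theta,X_1)\in d(\theta',x_1)|\Theta=\theta)$. *)

theory Defs
  imports "HOL-Probability.Probability"
begin

text \<open>
  A measurable space is represented by a measure \<open>M\<close> of which only \<open>space M\<close> and \<open>sets M\<close> matter.
  A Markov kernel from \<open>M\<close> to \<open>N\<close> is an element of \<open>M \<rightarrow>\<^sub>M prob_algebra N\<close>; the composition of a
  kernel \<open>Q\<close> with \<open>P\<close> is \<open>\<lambda>t. P t \<bind> Q\<close> (see \<open>emeasure_bind_prob_algebra\<close> for the integral formula).
\<close>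

definition at_least_as_informative ::
  "'t measure \<Rightarrow> 'a measure \<Rightarrow> 'b measure \<Rightarrow> ('t \<Rightarrow> 'a measure) \<Rightarrow> ('t \<Rightarrow> 'b measure) \<Rightarrow> bool"
  where
  "at_least_as_informative T M1 M2 P1 P2 \<longleftrightarrow>
     (\<exists>Q \<in> M1 \<rightarrow>\<^sub>M prob_algebra M2. \<forall>t \<in> space T. P2 t = P1 t \<bind> Q)"

text \<open>
  A transition probability space on \<open>W \<Otimes>\<^sub>M T\<close> is given by a kernel \<open>K \<in> T \<rightarrow>\<^sub>M prob_algebra W\<close>.
  Random variables are measurable functions of \<open>(w, t)\<close>. \<open>trans_law K N V t\<close> is the law
  \<open>K(V | T = t)\<close> of \<open>V\<close> on \<open>N\<close> when \<open>w\<close> is drawn from \<open>K t\<close>.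
\<close>

definition trans_law ::
  "('t \<Rightarrow> 'w measure) \<Rightarrow> 'v measure \<Rightarrow> ('w \<times> 't \<Rightarrow> 'v) \<Rightarrow> 't \<Rightarrow> 'v measure"
  where
  "trans_law K N V t = distr (K t) N (\<lambda>w. V (w, t))"

text \<open>
  The product \<open>Q(X | Z) \<otimes> L(Y, Z | T)\<close>: draw \<open>(y, z)\<close> from \<open>L t\<close>, then \<open>x\<close> from \<open>Q z\<close>, and return
  \<open>(x, y, z)\<close>.
\<close>

definition kernel_prod ::
  "'x measure \<Rightarrow> 'y measure \<Rightarrow> 'z measure \<Rightarrow> ('z \<Rightarrow> 'x measure) \<Rightarrow> ('t \<Rightarrow> ('y \<times> 'z) measure) \<Rightarrow>
   't \<Rightarrow> ('x \<times> 'y \<times> 'z) measure"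
  where
  "kernel_prod MX MY MZ Q L t =
     L t \<bind> (\<lambda>(y, z). distr (Q z) (MX \<Otimes>\<^sub>M MY \<Otimes>\<^sub>M MZ) (\<lambda>x. (x, y, z)))"

lemma emeasure_kernel_prod_rectangle:
  assumes Q: "Q \<in> MZ \<rightarrow>\<^sub>M prob_algebra MX"
    and L: "L t \<in> space (prob_algebra (MY \<Otimes>\<^sub>M MZ))"
    and [measurable]: "A \<in> sets MX" "D \<in> sets MY" "C \<in> sets MZ"
  shows "emeasure (kernel_prod MX MY MZ Q L t) (A \<times> D \<times> C) =
    (\<integral>\<^sup>+ (y, z). indicator D y * indicator C z * emeasure (Q z) A \<partial>L t)"
proof -
  note Q[measurable]
  let ?N = "MX \<Otimes>\<^sub>M MY \<Otimes>\<^sub>M MZ"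
  have sL: "sets (L t) = sets (MY \<Otimes>\<^sub>M MZ)" "space (L t) = space MY \<times> space MZ"
    using L by (auto simp: space_prob_algebra space_pair_measure dest: sets_eq_imp_space_eq)
  have k: "(\<lambda>(y, z). distr (Q z) ?N (\<lambda>x. (x, y, z))) \<in> MY \<Otimes>\<^sub>M MZ \<rightarrow>\<^sub>M prob_algebra ?N"
    unfolding case_prod_beta by measurable
  have "emeasure (kernel_prod MX MY MZ Q L t) (A \<times> D \<times> C) =
    (\<integral>\<^sup>+ p. emeasure ((\<lambda>(y, z). distr (Q z) ?N (\<lambda>x. (x, y, z))) p) (A \<times> D \<times> C) \<partial>L t)"
    unfolding kernel_prod_def by (rule emeasure_bind_prob_algebra[OF L k]) measurable
  also have "\<dots> = (\<integral>\<^sup>+ (y, z). indicator D y * indicator C z * emeasure (Q z) A \<partial>L t)"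
  proof (rule nn_integral_cong, clarify)
    fix y z assume "(y, z) \<in> space (L t)"
    then have y: "y \<in> space MY" and z: "z \<in> space MZ" by (auto simp: sL)
    have [measurable_cong]: "sets (Q z) = sets MX"
      using measurable_space[OF Q z] by (simp add: space_prob_algebra)
    have AQ: "A \<subseteq> space (Q z)" by (rule sets.sets_into_space) simp
    have "emeasure (distr (Q z) ?N (\<lambda>x. (x, y, z))) (A \<times> D \<times> C) =
      emeasure (Q z) ((\<lambda>x. (x, y, z)) -` (A \<times> D \<times> C) \<inter> space (Q z))"
      using y z by (intro emeasure_distr) measurable
    also have "(\<lambda>x. (x, y, z)) -` (A \<times> D \<times> C) \<inter> space (Q z) = (if y \<in> D \<and> z \<in> C then A else {})"
      using AQ by auto
    finally show "emeasure (distr (Q z) ?N (\<lambda>x. (x, y, z))) (A \<times> D \<times> C) =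
      indicator D y * indicator C z * emeasure (Q z) A"
      by (auto split: split_indicator)
  qed
  finally show ?thesis .
qed

text \<open>
  Transitional conditional independence of \<open>X\<close> from \<open>Y\<close> given \<open>Z\<close>, for random variables
  \<open>X\<close>, \<open>Y\<close>, \<open>Z\<close> on the transition probability space \<open>(W \<Otimes>\<^sub>M T, K)\<close> with values in
  \<open>MX\<close>, \<open>MY\<close>, \<open>MZ\<close>. The space \<open>W\<close> enters only through \<open>K\<close>. The notion is not symmetric in
  \<open>X\<close> and \<open>Y\<close>.
\<close>

definition trans_cond_indep ::
  "'t measure \<Rightarrow> ('t \<Rightarrow> 'w measure) \<Rightarrow> 'x measure \<Rightarrow> 'y measure \<Rightarrow> 'z measure \<Rightarrow>
   ('w \<times> 't \<Rightarrow> 'x) \<Rightarrow> ('w \<times> 't \<Rightarrow> 'y) \<Rightarrow> ('w \<times> 't \<Rightarrow> 'z) \<Rightarrow> bool"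
  where
  "trans_cond_indep T K MX MY MZ X Y Z \<longleftrightarrow>
     (\<exists>Q \<in> MZ \<rightarrow>\<^sub>M prob_algebra MX. \<forall>t \<in> space T.
        trans_law K (MX \<Otimes>\<^sub>M MY \<Otimes>\<^sub>M MZ) (\<lambda>\<omega>. (X \<omega>, Y \<omega>, Z \<omega>)) t =
        kernel_prod MX MY MZ Q (trans_law K (MY \<Otimes>\<^sub>M MZ) (\<lambda>\<omega>. (Y \<omega>, Z \<omega>))) t)"

end

theory Submission imports Defs begin

text \<open>
  The garbling \<open>Q\<close> in the first condition and the conditional law \<open>Q\<close> that witnesses the
  independence in the second are the same kernel. Given a garbling \<open>Q\<close>, run
  the first experiment and feed its outcome \<open>x1\<close> to \<open>Q\<close>; the law of the resulting pair
  \<open>(x1, x2)\<close> is a coupling whose second marginal is the garbled experiment. Conversely,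
  conditional independence of \<open>x2\<close> from the parameter given \<open>x1\<close> says that every \<open>K \<theta>\<close>
  disintegrates over its first marginal with one and the same conditional law \<open>Q\<close>; integrating
  \<open>x1\<close> out exhibits the second marginal as the first one garbled by \<open>Q\<close>.

  The reading of conditional independence as a disintegration is
  \<open>trans_cond_indep_parameter_iff\<close>. Under \<open>K \<theta>\<close> the parameter is the constant \<open>\<theta>\<close>, so the
  defining equation compares the images of two laws of \<open>(x1, x2)\<close> under
  \<open>(x1, x2) \<mapsto> (x2, \<theta>, x1)\<close>, and a map with a measurable left inverse loses nothing.
  The two marginals of a disintegrated law are computed in \<open>attach_kernel_marginals\<close>.
\<close>

text \<open>
  The semidirect product of \<open>P\<close> and \<open>Q\<close>: the joint law with first marginal \<open>P\<close> for which \<open>Q\<close>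
  is a conditional law of the second coordinate given the first.
\<close>

definition attach_kernel ::
  "'a measure \<Rightarrow> 'b measure \<Rightarrow> 'a measure \<Rightarrow> ('a \<Rightarrow> 'b measure) \<Rightarrow> ('a \<times> 'b) measure"
  where "attach_kernel M N P Q = P \<bind> (\<lambda>x. distr (Q x) (M \<Otimes>\<^sub>M N) (Pair x))"

lemma measurable_attach_kernel:
  assumes [measurable]: "Q \<in> M \<rightarrow>\<^sub>M prob_algebra N" "P \<in> T \<rightarrow>\<^sub>M prob_algebra M"
  shows "(\<lambda>t. attach_kernel M N (P t) Q) \<in> T \<rightarrow>\<^sub>M prob_algebra (M \<Otimes>\<^sub>M N)"
  unfolding attach_kernel_def by measurable

lemma distr_attach_kernel:
  assumes Q[measurable]: "Q \<in> M \<rightarrow>\<^sub>M prob_algebra N"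
    and P: "P \<in> space (prob_algebra M)"
    and h[measurable]: "h \<in> M \<Otimes>\<^sub>M N \<rightarrow>\<^sub>M L"
  shows "distr (attach_kernel M N P Q) L h = P \<bind> (\<lambda>x. distr (Q x) L (\<lambda>y. h (x, y)))"
proof -
  interpret P: prob_space P using P by (simp add: space_prob_algebra)
  have sP[measurable_cong]: "sets P = sets M" using P by (simp add: space_prob_algebra)
  have k: "(\<lambda>x. distr (Q x) (M \<Otimes>\<^sub>M N) (Pair x)) \<in> P \<rightarrow>\<^sub>M subprob_algebra (M \<Otimes>\<^sub>M N)"
    by (rule measurable_prob_algebraD) measurable
  have "distr (attach_kernel M N P Q) L h =
      P \<bind> (\<lambda>x. distr (distr (Q x) (M \<Otimes>\<^sub>M N) (Pair x)) L h)"
    unfolding attach_kernel_def by (rule distr_bind[OF k P.not_empty h])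
  also have "\<dots> = P \<bind> (\<lambda>x. distr (Q x) L (\<lambda>y. h (x, y)))"
  proof (rule bind_cong[OF refl])
    fix x assume "x \<in> space P"
    then have x: "x \<in> space M" by (simp add: sets_eq_imp_space_eq[OF sP])
    have [measurable_cong]: "sets (Q x) = sets N"
      using measurable_space[OF Q x] by (simp add: space_prob_algebra)
    show "distr (distr (Q x) (M \<Otimes>\<^sub>M N) (Pair x)) L h = distr (Q x) L (\<lambda>y. h (x, y))"
      using x by (subst distr_distr) (auto simp: comp_def)
  qed
  finally show ?thesis .
qed

lemma attach_kernel_marginals:
  assumes Q[measurable]: "Q \<in> M \<rightarrow>\<^sub>M prob_algebra N"
    and P: "P \<in> space (prob_algebra M)"
  shows "distr (attach_kernel M N P Q) M fst = P"
    and "distr (attach_kernel M N P Q) N snd = P \<bind> Q"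
proof -
  interpret P: prob_space P using P by (simp add: space_prob_algebra)
  have sP[measurable_cong]: "sets P = sets M" using P by (simp add: space_prob_algebra)
  note space_P = sets_eq_imp_space_eq[OF sP]
  have sQ: "prob_space (Q x)" "sets (Q x) = sets N" if "x \<in> space P" for x
    using measurable_space[OF Q] that space_P by (auto simp: space_prob_algebra)
  have "distr (attach_kernel M N P Q) M fst = P \<bind> (\<lambda>x. distr (Q x) M (\<lambda>_. x))"
    by (simp add: distr_attach_kernel[OF Q P])
  also have "\<dots> = P \<bind> return P"
  proof (rule bind_cong[OF refl])
    fix x assume x: "x \<in> space P"
    interpret Q: prob_space "Q x" using sQ x by blast
    show "distr (Q x) M (\<lambda>_. x) = return P x"
      using x space_P Q.distr_const[of x M] by (simp add: return_cong[OF sP])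
  qed
  also have "\<dots> = P" by (rule bind_return'') simp
  finally show "distr (attach_kernel M N P Q) M fst = P" .
  show "distr (attach_kernel M N P Q) N snd = P \<bind> Q"
    unfolding distr_attach_kernel[OF Q P measurable_snd]
    by (rule bind_cong[OF refl]) (use sQ in \<open>simp add: distr_id2\<close>)
qed

text \<open>Pushing forward along the left inverse recovers the measure from its image.\<close>

lemma distr_eq_iff_of_left_inverse:
  assumes sM: "sets M = sets W" and sN: "sets N = sets W"
    and f: "f \<in> W \<rightarrow>\<^sub>M L" and g: "g \<in> L \<rightarrow>\<^sub>M W"
    and gf: "\<And>w. w \<in> space W \<Longrightarrow> g (f w) = w"
  shows "distr M L f = distr N L f \<longleftrightarrow> M = N"
proof
  have recover: "distr (distr R L f) W g = R" if sR: "sets R = sets W" for R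
  proof -
    have "distr (distr R L f) W g = distr R W (g \<circ> f)"
      using f g sR by (intro distr_distr) (auto cong: measurable_cong_sets)
    also have "\<dots> = distr R R (\<lambda>w. w)"
      using gf sets_eq_imp_space_eq[OF sR] sR by (intro distr_cong) auto
    finally show ?thesis by simp
  qed
  assume "distr M L f = distr N L f"
  then show "M = N" using recover[OF sM] recover[OF sN] by metis
qed simp

text \<open>
  The law of \<open>(\<theta>, x1)\<close> under \<open>K \<theta>\<close> is the first marginal of \<open>K \<theta>\<close> with a point mass at \<open>\<theta>\<close>
  adjoined, so drawing from this law before applying \<open>Q\<close> amounts to drawing \<open>x1\<close> alone.
\<close>

lemma kernel_prod_eq_distr_attach_kernel:
  assumes Q[measurable]: "Q \<in> M1 \<rightarrow>\<^sub>M prob_algebra M2"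
    and t: "t \<in> space T"
    and K: "K t \<in> space (prob_algebra (M1 \<Otimes>\<^sub>M M2))"
  shows "kernel_prod M2 T M1 Q (trans_law K (T \<Otimes>\<^sub>M M1) (\<lambda>\<omega>. (snd \<omega>, fst (fst \<omega>)))) t =
    distr (attach_kernel M1 M2 (distr (K t) M1 fst) Q) (M2 \<Otimes>\<^sub>M T \<Otimes>\<^sub>M M1)
      (\<lambda>(x1, x2). (x2, t, x1))"
proof -
  interpret K: prob_space "K t" using K by (simp add: space_prob_algebra)
  have sK[measurable_cong]: "sets (K t) = sets (M1 \<Otimes>\<^sub>M M2)" using K by (simp add: space_prob_algebra)
  have P: "distr (K t) M1 fst \<in> space (prob_algebra M1)"
    by (simp add: space_prob_algebra K.prob_space_distr)
  interpret P': prob_space "distr (K t) M1 fst" using P by (simp add: space_prob_algebra)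
  let ?L = "M2 \<Otimes>\<^sub>M T \<Otimes>\<^sub>M M1"
  have k: "(\<lambda>(y, z). distr (Q z) ?L (\<lambda>x. (x, y, z))) \<in> T \<Otimes>\<^sub>M M1 \<rightarrow>\<^sub>M subprob_algebra ?L"
    unfolding case_prod_beta by (rule measurable_prob_algebraD) measurable
  have m: "(\<lambda>z. (t, z)) \<in> M1 \<rightarrow>\<^sub>M T \<Otimes>\<^sub>M M1"
    using t by measurable
  have "trans_law K (T \<Otimes>\<^sub>M M1) (\<lambda>\<omega>. (snd \<omega>, fst (fst \<omega>))) t =
      distr (distr (K t) M1 fst) (T \<Otimes>\<^sub>M M1) (\<lambda>z. (t, z))"
    unfolding trans_law_def by (subst distr_distr[OF m]) (auto simp: comp_def)
  then have "kernel_prod M2 T M1 Q (trans_law K (T \<Otimes>\<^sub>M M1) (\<lambda>\<omega>. (snd \<omega>, fst (fst \<omega>)))) t =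
      distr (K t) M1 fst \<bind> (\<lambda>z. distr (Q z) ?L (\<lambda>x. (x, t, z)))"
    using m P P'.not_empty by (simp add: kernel_prod_def bind_distr[OF _ k])
  also have "\<dots> = distr (attach_kernel M1 M2 (distr (K t) M1 fst) Q) ?L (\<lambda>(x1, x2). (x2, t, x1))"
    using t by (subst distr_attach_kernel[OF Q P]) auto
  finally show ?thesis .
qed

text \<open>
  The common image space carries a copy of \<open>\<theta>\<close> next to the pair. Dropping that copy is the
  left inverse that reduces the equation of laws of \<open>(x2, \<theta>, x1)\<close> to one of laws of \<open>(x1, x2)\<close>.
\<close>

lemma trans_cond_indep_parameter_iff:
  assumes K: "K \<in> T \<rightarrow>\<^sub>M prob_algebra (M1 \<Otimes>\<^sub>M M2)"
  shows "trans_cond_indep T K M2 T M1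
      (\<lambda>((x1, x2), \<theta>). x2) (\<lambda>((x1, x2), \<theta>). \<theta>) (\<lambda>((x1, x2), \<theta>). x1) \<longleftrightarrow>
    (\<exists>Q \<in> M1 \<rightarrow>\<^sub>M prob_algebra M2. \<forall>t \<in> space T.
       K t = attach_kernel M1 M2 (distr (K t) M1 fst) Q)"
proof -
  let ?L = "M2 \<Otimes>\<^sub>M T \<Otimes>\<^sub>M M1"
  have "trans_law K ?L (\<lambda>\<omega>. (snd (fst \<omega>), snd \<omega>, fst (fst \<omega>))) t =
      kernel_prod M2 T M1 Q (trans_law K (T \<Otimes>\<^sub>M M1) (\<lambda>\<omega>. (snd \<omega>, fst (fst \<omega>)))) t \<longleftrightarrow>
      K t = attach_kernel M1 M2 (distr (K t) M1 fst) Q"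
    if Q: "Q \<in> M1 \<rightarrow>\<^sub>M prob_algebra M2" and t: "t \<in> space T" for Q t
  proof -
    have Kt: "K t \<in> space (prob_algebra (M1 \<Otimes>\<^sub>M M2))" by (rule measurable_space[OF K t])
    interpret K: prob_space "K t" using Kt by (simp add: space_prob_algebra)
    have sK[measurable_cong]: "sets (K t) = sets (M1 \<Otimes>\<^sub>M M2)"
      using Kt by (simp add: space_prob_algebra)
    have "(\<lambda>_. distr (K t) M1 fst) \<in> T \<rightarrow>\<^sub>M prob_algebra M1"
      by (rule measurable_const) (simp add: space_prob_algebra K.prob_space_distr)
    from measurable_space[OF measurable_attach_kernel[OF Q this] t]
    have sA: "sets (attach_kernel M1 M2 (distr (K t) M1 fst) Q) = sets (M1 \<Otimes>\<^sub>M M2)"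
      by (simp add: space_prob_algebra)
    have "trans_law K ?L (\<lambda>\<omega>. (snd (fst \<omega>), snd \<omega>, fst (fst \<omega>))) t =
        distr (K t) ?L (\<lambda>(x1, x2). (x2, t, x1))"
      by (simp add: trans_law_def case_prod_unfold)
    moreover have "distr (K t) ?L (\<lambda>(x1, x2). (x2, t, x1)) =
        distr (attach_kernel M1 M2 (distr (K t) M1 fst) Q) ?L (\<lambda>(x1, x2). (x2, t, x1)) \<longleftrightarrow>
        K t = attach_kernel M1 M2 (distr (K t) M1 fst) Q"
      by (rule distr_eq_iff_of_left_inverse[OF sK sA,
            where g = "\<lambda>(x2, \<theta>, x1). (x1, x2)"])
        (use t in \<open>auto simp: case_prod_beta\<close>)
    ultimately show ?thesis
      by (simp add: kernel_prod_eq_distr_attach_kernel[where K = K, OF Q t Kt])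
  qed
  then show ?thesis
    unfolding trans_cond_indep_def case_prod_beta by (intro bex_cong ball_cong refl) auto
qed

theorem theorem4p9:
  fixes \<Theta> :: "'t measure" and M1 :: "'a measure" and M2 :: "'b measure"
    and P1 :: "'t \<Rightarrow> 'a measure" and P2 :: "'t \<Rightarrow> 'b measure"
  assumes "P1 \<in> \<Theta> \<rightarrow>\<^sub>M prob_algebra M1"
    and "P2 \<in> \<Theta> \<rightarrow>\<^sub>M prob_algebra M2"
  shows "at_least_as_informative \<Theta> M1 M2 P1 P2 \<longleftrightarrow>
    (\<exists>K \<in> \<Theta> \<rightarrow>\<^sub>M prob_algebra (M1 \<Otimes>\<^sub>M M2).
       (\<forall>\<theta> \<in> space \<Theta>. distr (K \<theta>) M1 fst = P1 \<theta> \<and> distr (K \<theta>) M2 snd = P2 \<theta>) \<and>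
       trans_cond_indep \<Theta> K M2 \<Theta> M1
         (\<lambda>((x1, x2), \<theta>). x2) (\<lambda>((x1, x2), \<theta>). \<theta>) (\<lambda>((x1, x2), \<theta>). x1))"
    (is "?inf \<longleftrightarrow> (\<exists>K \<in> ?kernels. ?marg K \<and> ?indep K)")
proof
  note P1 = measurable_space[OF assms(1)]
  assume ?inf
  then obtain Q where Q: "Q \<in> M1 \<rightarrow>\<^sub>M prob_algebra M2"
    and P2: "\<And>\<theta>. \<theta> \<in> space \<Theta> \<Longrightarrow> P2 \<theta> = P1 \<theta> \<bind> Q"
    unfolding at_least_as_informative_def by blast
  let ?K = "\<lambda>\<theta>. attach_kernel M1 M2 (P1 \<theta>) Q"
  have K: "?K \<in> ?kernels" by (rule measurable_attach_kernel[OF Q assms(1)])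
  have marg: "?marg ?K" using attach_kernel_marginals[OF Q P1] P2 by simp
  then have "?indep ?K" unfolding trans_cond_indep_parameter_iff[OF K] using Q by auto
  with K marg show "\<exists>K \<in> ?kernels. ?marg K \<and> ?indep K"
    by (intro bexI[where x = ?K] conjI)
next
  note P1 = measurable_space[OF assms(1)]
  assume "\<exists>K \<in> ?kernels. ?marg K \<and> ?indep K"
  then obtain K where K: "K \<in> ?kernels" and marg: "?marg K" and "?indep K" by blast
  then obtain Q where Q: "Q \<in> M1 \<rightarrow>\<^sub>M prob_algebra M2"
    and KQ: "\<And>\<theta>. \<theta> \<in> space \<Theta> \<Longrightarrow> K \<theta> = attach_kernel M1 M2 (P1 \<theta>) Q"
    unfolding trans_cond_indep_parameter_iff[OF K] by metis
  have "P2 \<theta> = P1 \<theta> \<bind> Q" if "\<theta> \<in> space \<Theta>" for \<theta>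
    using marg KQ[OF that] attach_kernel_marginals(2)[OF Q P1[OF that]] that by metis
  with Q show ?inf unfolding at_least_as_informative_def by blast
qed

end
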